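(* We have $C_{Q_7,\mathbf 1}=9$.
   Context: $\mathbb Z_7=\mathbb Z/7\mathbb Z$ and $Q_7=\{1,2,4\}$ is the set of non-zero squares in $\mathbb Z_7$. A sequence of length $k$ in $\mathbb Z_7$ is an element of $\mathbb Z_7^k$. A sequence $(x_1,\ldots,x_k)$ in $\mathbb Z_7$ is called a $(Q_7,\mathbf 1)$-weighted zero-sum sequence if there exist $a_1,\ldots,a_k\in Q_7$ such that $a_1x_1+\cdots+a_kx_k=0$ and $a_1+\cdots+a_k=0$ in $\mathbb Z_7$. The constant $C_{Q_7,\mathbf 1}$ is the least positive integer $k$ such that every sequence in $\mathbb Z_7$ of length $k$ has a (non-empty) $(Q_7,\mathbf 1)$-weighted zero-sum subsequence consisting of consecutive terms. *)

theory Defs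
  imports "HOL-Library.Numeral_Type" "HOL-Library.Sublist"
begin

text \<open>
  The numeral type \<^typ>\<open>7\<close> of HOL-Library.Numeral_Type, whose ring operations are
  arithmetic modulo 7, represents the ring of integers modulo 7. Sequences are lists.
\<close>

definition Q7 :: "7 set" where
  "Q7 = {x\<^sup>2 | x. x\<^sup>2 \<noteq> 0}"

lemma Q7_eq: "Q7 = {1, 2, 4}"
proof -
  have U: "(UNIV :: 7 set) = {0, 1, 2, 3, 4, 5, 6}"
    by (rule card_seteq [symmetric]) auto
  have "Q7 = (\<lambda>x. x\<^sup>2) ` UNIV - {0}"
    by (auto simp: Q7_def)
  also have "\<dots> = {0, 1, 4, 9, 16, 25, 36} - {0}"
    unfolding U by (simp add: power2_eq_square)
  finally have "Q7 = {0, 1, 4, 9, 16, 25, 36} - {0}" .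
  moreover have "(9 :: 7) = 2 \<and> (16 :: 7) = 2 \<and> (25 :: 7) = 4 \<and> (36 :: 7) = 1"
    by simp
  ultimately show ?thesis
    by auto
qed

definition weighted_zero_sum :: "'a::comm_ring_1 set \<Rightarrow> 'a list \<Rightarrow> bool" where
  "weighted_zero_sum A xs \<longleftrightarrow>
     (\<exists>as. length as = length xs \<and> set as \<subseteq> A \<and>
        (\<Sum>i<length xs. as ! i * xs ! i) = 0 \<and> (\<Sum>i<length xs. as ! i) = 0)"

text \<open>
  \<^const>\<open>sublist\<close> means contiguous sublist.
\<close>

definition C_const :: "'a::comm_ring_1 set \<Rightarrow> nat" where
  "C_const A = (LEAST k. k > 0 \<and>
     (\<forall>xs. length xs = k \<longrightarrow>
        (\<exists>ys. sublist ys xs \<and> ys \<noteq> [] \<and> weighted_zero_sum A ys)))"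

end

theory Submission imports Defs begin

text \<open>
  Lower bound: in \<open>[0,0,1,0,0,1,0,0]\<close>, a weighted zero-sum block would make the one or two
  weights sitting on its ones sum to zero, which is impossible as \<open>-1\<close> is not a square modulo 7;
  and a block without ones has length at most 2, so that the same obstruction applies to the sum of
  all weights.

  Upper bound: both conditions are preserved by affine maps \<open>x \<mapsto> u x + c\<close>, so one may assume
  that a sequence (read from its end) begins with \<open>0,1\<close>, \<open>0,0,1\<close> or \<open>0,0,0\<close>.
  The remaining tree of sequences is searched by computing, for each sequence, the pairs of sums
  that are attained by the blocks ending at the last term added; only about 80 sequences
  without a zero-sum block survive, all of length at most 8.
\<close>

section \<open>Pairs of weighted sums and affine maps\<close>

definition weighted_sums :: "'a::comm_ring_1 set \<Rightarrow> 'a list \<Rightarrow> ('a \<times> 'a) set" where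
  "weighted_sums A xs =
     {(\<Sum>i<length xs. as ! i * xs ! i, \<Sum>i<length xs. as ! i) | as.
        length as = length xs \<and> set as \<subseteq> A}"

definition has_zero_sum_block :: "'a::comm_ring_1 set \<Rightarrow> 'a list \<Rightarrow> bool" where
  "has_zero_sum_block A xs \<longleftrightarrow>
     (\<exists>ys. sublist ys xs \<and> ys \<noteq> [] \<and> weighted_zero_sum A ys)"

text \<open>Pairing the two sums under common weights turns the property into a membership that can
  be followed one term at a time.\<close>

lemma weighted_zero_sum_iff: "weighted_zero_sum A xs \<longleftrightarrow> (0, 0) \<in> weighted_sums A xs"
  unfolding weighted_zero_sum_def weighted_sums_def by (simp add: eq_commute[of 0] conj_ac)

lemma weighted_sums_Nil: "weighted_sums A [] = {(0, 0)}"
  by (auto simp: weighted_sums_def)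

lemma weighted_sums_Cons:
  "weighted_sums A (x # xs) = {(a * x + s, a + t) | a s t. a \<in> A \<and> (s, t) \<in> weighted_sums A xs}"
    (is "?L = ?R")
proof
  show "?L \<subseteq> ?R"
  proof
    fix p assume "p \<in> ?L"
    then obtain as where as: "length as = Suc (length xs)" "set as \<subseteq> A"
      "p = (\<Sum>i<Suc (length xs). as ! i * (x # xs) ! i, \<Sum>i<Suc (length xs). as ! i)"
      by (auto simp: weighted_sums_def)
    then obtain a bs where "as = a # bs"
      by (cases as) auto
    with as show "p \<in> ?R"
      unfolding weighted_sums_def
      by (auto simp: sum.lessThan_Suc_shift simp del: sum.lessThan_Suc)
  qed
  show "?R \<subseteq> ?L"
  proof
    fix p assume "p \<in> ?R"
    then obtain a bs where "a \<in> A" "length bs = length xs" "set bs \<subseteq> A"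
      "p = (a * x + (\<Sum>i<length xs. bs ! i * xs ! i), a + (\<Sum>i<length xs. bs ! i))"
      by (auto simp: weighted_sums_def)
    then show "p \<in> ?L"
      unfolding weighted_sums_def
      by (auto simp: sum.lessThan_Suc_shift simp del: sum.lessThan_Suc intro!: exI[of _ "a # bs"])
  qed
qed

text \<open>For weights with total \<open>t\<close>, scaling the terms by \<open>u\<close> scales
  \<open>s\<close>, and adding \<open>c\<close> to each term adds \<open>c * t\<close>. In
  particular \<open>(0, 0)\<close> stays \<open>(0, 0)\<close>.\<close>

lemma weighted_sums_affine:
  "(s, t) \<in> weighted_sums A xs \<Longrightarrow>
     (u * s + c * t, t) \<in> weighted_sums A (map (\<lambda>x. u * x + c) xs)"
proof (induction xs arbitrary: s t)
  case Nil
  then show ?case by (simp add: weighted_sums_Nil)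
next
  case (Cons x xs)
  then obtain a s' t' where *: "a \<in> A" "(s', t') \<in> weighted_sums A xs"
    "s = a * x + s'" "t = a + t'"
    by (auto simp: weighted_sums_Cons)
  have "u * s + c * t = a * (u * x + c) + (u * s' + c * t')"
    by (simp add: * algebra_simps)
  with * Cons.IH show ?case
    unfolding list.map weighted_sums_Cons by blast
qed

lemma has_zero_sum_block_affine:
  assumes "has_zero_sum_block A xs"
  shows "has_zero_sum_block A (map (\<lambda>x. u * x + c) xs)"
proof -
  obtain ys where "sublist ys xs" "ys \<noteq> []" "(0, 0) \<in> weighted_sums A ys"
    using assms by (auto simp: has_zero_sum_block_def weighted_zero_sum_iff)
  then show ?thesis
    using weighted_sums_affine[of 0 0 A ys u c] map_mono_sublist[of ys xs]
    unfolding has_zero_sum_block_def weighted_zero_sum_iff by fastforce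
qed

lemma has_zero_sum_block_mono:
  "has_zero_sum_block A xs \<Longrightarrow> sublist xs zs \<Longrightarrow> has_zero_sum_block A zs"
  by (auto simp: has_zero_sum_block_def intro: sublist_order.order_trans)

subsection \<open>The lower bound\<close>

text \<open>A single weight is non-zero, and two weights cannot cancel because the negatives 6, 5, 3
  of 1, 2, 4 lie outside \<open>Q7\<close>.\<close>

lemma no_zero_sum_Q7:
  assumes "set as \<subseteq> Q7" "length as \<in> {1, 2}"
  shows "sum_list as \<noteq> 0"
proof -
  obtain a b where "as = [a] \<or> as = [a, b]"
    using assms(2) by (auto simp: length_Suc_conv eval_nat_numeral)
  then show ?thesis
    using assms(1) unfolding Q7_eq by auto
qed

lemma weighted_sums_snd:
  "(s, t) \<in> weighted_sums A xs \<Longrightarrow>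
     \<exists>as. length as = length xs \<and> set as \<subseteq> A \<and> t = sum_list as"
  by (auto simp: weighted_sums_def sum_list_sum_nth atLeast0LessThan)

text \<open>A term 0 contributes nothing and a term 1 contributes its weight, so only the weights on
  the ones remain.\<close>

lemma weighted_sums_fst_0_1:
  "(s, t) \<in> weighted_sums A xs \<Longrightarrow> set xs \<subseteq> {0, 1} \<Longrightarrow>
     \<exists>as. length as = count_list xs 1 \<and> set as \<subseteq> A \<and> s = sum_list as"
proof (induction xs arbitrary: s t)
  case Nil
  then show ?case by (simp add: weighted_sums_Nil)
next
  case (Cons x xs)
  then obtain a s' t' where *: "a \<in> A" "(s', t') \<in> weighted_sums A xs" "s = a * x + s'"
    by (auto simp: weighted_sums_Cons)
  obtain as where as: "length as = count_list xs 1" "set as \<subseteq> A" "s' = sum_list as"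
    using Cons.IH[OF *(2)] Cons.prems(2) by auto
  show ?case
  proof (cases "x = 1")
    case True
    then show ?thesis
      using * as by (intro exI[of _ "a # as"]) auto
  next
    case False
    then show ?thesis
      using * as Cons.prems(2) by (intro exI[of _ as]) auto
  qed
qed

lemma no_zero_sum_block_8: "\<not> has_zero_sum_block Q7 [0, 0, 1, 0, 0, 1, 0, 0]"
proof
  let ?w = "[0, 0, 1, 0, 0, 1, 0, 0] :: 7 list"
  assume "has_zero_sum_block Q7 ?w"
  then obtain ys where ys: "sublist ys ?w" "ys \<noteq> []" "(0, 0) \<in> weighted_sums Q7 ys"
    by (auto simp: has_zero_sum_block_def weighted_zero_sum_iff)
  \<comment> \<open>All blocks are enumerated here. A non-empty one that misses both ones lies in a
    run of two zeros; any other contains one or two ones.\<close>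
  have "set (sublists ?w) \<subseteq> {[]} \<union> {ys. set ys \<subseteq> {0, 1} \<and> (count_list ys 1 \<in> {1, 2} \<or> length ys \<in> {1, 2})}"
    by (simp del: set_sublists_eq)
  then have "set ys \<subseteq> {0, 1} \<and> (count_list ys 1 \<in> {1, 2} \<or> length ys \<in> {1, 2})"
    using ys(1,2) unfolding set_sublists_eq by blast
  then show False
    using weighted_sums_snd[OF ys(3)] weighted_sums_fst_0_1[OF ys(3)] no_zero_sum_Q7 by metis
qed

subsection \<open>The upper bound\<close>

text \<open>Residues are represented by integers, on which \<open>code_simp\<close> can compute.\<close>

definition add7 :: "int \<Rightarrow> int \<Rightarrow> int" where
  "add7 m n = (let k = m + n in if k < 7 then k else k - 7)"

text \<open>\<open>P\<close> lists the pairs of the non-empty prefixes; the added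
  \<open>(0, 0)\<close> stands for the empty one, so that \<open>x\<close> alone is also a block.
  \<open>List.union\<close> with \<open>[]\<close> removes duplicates, which keeps the search
  small.\<close>

definition extend_sums :: "int \<Rightarrow> (int \<times> int) list \<Rightarrow> (int \<times> int) list" where
  "extend_sums x P = List.union
     (map (\<lambda>((m, a), (s, t)). (add7 m s, add7 a t))
       (List.product (map (\<lambda>a. (a * x mod 7, a)) [1, 2, 4]) ((0, 0) # P))) []"

text \<open>Putting \<open>x\<close> in front closes a zero-sum block when some prefix attains the
  negative of the pair contributed by \<open>x\<close>. Reducing mod 7 makes the integers comparable
  with the entries of \<open>P\<close>.\<close>

definition blocks :: "int \<Rightarrow> (int \<times> int) list \<Rightarrow> bool" where
  "blocks x P \<longleftrightarrow> (\<exists>a \<in> set [1, 2, 4]. (- (a * x) mod 7, - a mod 7) \<in> set P)"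

text \<open>Depth-first search with \<open>n\<close> terms still to add: a branch ends as soon as a
  block closes, and reaching depth 0 without one is failure.\<close>

fun all_extensions_blocked :: "nat \<Rightarrow> (int \<times> int) list \<Rightarrow> bool" where
  "all_extensions_blocked 0 P \<longleftrightarrow> False"
| "all_extensions_blocked (Suc n) P \<longleftrightarrow>
     (\<forall>x \<in> set [0, 1, 2, 3, 4, 5, 6]. blocks x P \<or> all_extensions_blocked n (extend_sums x P))"

text \<open>Soundness invariant of the search: a pair found in \<open>P\<close> yields an actual
  block at the front of the list.\<close>

definition attained_at_front :: "(int \<times> int) list \<Rightarrow> 7 list \<Rightarrow> bool" where
  "attained_at_front P xs \<longleftrightarrow>
     (\<forall>(s, t) \<in> set P. \<exists>ys. ys \<noteq> [] \<and> prefix ys xs \<and>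
        (of_int s, of_int t) \<in> weighted_sums Q7 ys)"

lemma UNIV_7: "(UNIV :: 7 set) = {0, 1, 2, 3, 4, 5, 6}"
  by (rule card_seteq [symmetric]) auto

lemma of_int_mod_7: "(of_int (n mod 7) :: 7) = of_int n"
  by (simp add: bit1.of_int_eq)

lemma of_int_add7: "(of_int (add7 m n) :: 7) = of_int m + of_int n"
  by (simp add: add7_def Let_def)

lemma ex_int_residue: "\<exists>n \<in> set [0, 1, 2, 3, 4, 5, 6]. (x :: 7) = of_int n"
  using UNIV_I[of x] unfolding UNIV_7 by auto

lemma of_int_in_Q7: "a \<in> set [1, 2, 4] \<Longrightarrow> of_int a \<in> Q7"
  by (auto simp: Q7_eq)

lemma attained_at_front_Nil: "attained_at_front [] xs"
  by (simp add: attained_at_front_def)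

lemma attained_at_front_extend:
  assumes "attained_at_front P xs"
  shows "attained_at_front (extend_sums x P) (of_int x # xs)"
  unfolding attained_at_front_def
proof safe
  fix s t assume "(s, t) \<in> set (extend_sums x P)"
  then obtain s' t' a where st: "(s', t') \<in> set ((0, 0) # P)" and a: "a \<in> set [1, 2, 4 :: int]"
    and eq: "s = add7 (a * x mod 7) s'" "t = add7 a t'"
    unfolding extend_sums_def set_union set_map set_product
    by (elim UnE imageE SigmaE) (auto simp del: list.set(2))
  \<comment> \<open>The prefix may be empty here, which accounts for the extra pair
    \<open>(0, 0)\<close>.\<close>
  obtain ys where ys: "prefix ys xs" "(of_int s', of_int t') \<in> weighted_sums Q7 ys"
  proof (cases "(s', t') \<in> set P")
    case True
    then show thesis using assms that by (fastforce simp: attained_at_front_def)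
  next
    case False
    then show thesis using st that[of "[]"] by (simp add: weighted_sums_Nil)
  qed
  have "(of_int s, of_int t) \<in> weighted_sums Q7 (of_int x # ys)"
    using ys(2) of_int_in_Q7[OF a]
    unfolding eq of_int_add7 of_int_mod_7 of_int_mult weighted_sums_Cons by blast
  then show "\<exists>ys. ys \<noteq> [] \<and> prefix ys (of_int x # xs) \<and>
      (of_int s, of_int t) \<in> weighted_sums Q7 ys"
    using ys(1) by (intro exI[of _ "of_int x # ys"]) auto
qed

lemma has_zero_sum_block_if_blocks:
  assumes "attained_at_front P xs" "blocks x P"
  shows "has_zero_sum_block Q7 (of_int x # xs)"
proof -
  obtain a where a: "a \<in> set [1, 2, 4]" "(- (a * x) mod 7, - a mod 7) \<in> set P"
    using assms(2) unfolding blocks_def by blast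
  then obtain ys where ys: "prefix ys xs"
    "(of_int (- (a * x) mod 7), of_int (- a mod 7)) \<in> weighted_sums Q7 ys"
    using assms(1) unfolding attained_at_front_def by blast
  have "(of_int a * of_int x + of_int (- (a * x) mod 7), of_int a + of_int (- a mod 7))
      \<in> weighted_sums Q7 (of_int x # ys)"
    using ys(2) of_int_in_Q7[OF a(1)] unfolding weighted_sums_Cons by blast
  then have "(0, 0) \<in> weighted_sums Q7 (of_int x # ys)"
    unfolding of_int_mod_7 by simp
  moreover have "prefix (of_int x # ys) (of_int x # xs)"
    using ys(1) by simp
  ultimately show ?thesis
    unfolding has_zero_sum_block_def weighted_zero_sum_iff
    using prefix_imp_sublist by blast
qed

text \<open>Induction along the search tree. Terms are added at the front, so \<open>ws\<close> in
  order of addition appears reversed.\<close>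

lemma has_zero_sum_block_if_blocked:
  assumes "all_extensions_blocked n P" "attained_at_front P xs" "length ws = n"
  shows "has_zero_sum_block Q7 (rev ws @ xs)"
  using assms
proof (induction n P arbitrary: xs ws rule: all_extensions_blocked.induct)
  case (1 P)
  then show ?case by simp
next
  case (2 n P)
  obtain w ws' where ws: "ws = w # ws'"
    using 2 by (cases ws) auto
  obtain k where k: "k \<in> set [0, 1, 2, 3, 4, 5, 6]" "w = of_int k"
    using ex_int_residue by blast
  have "has_zero_sum_block Q7 (rev ws' @ (w # xs))"
  proof (cases "blocks k P")
    case True
    \<comment> \<open>A block closed early survives the addition of the remaining terms.\<close>
    then have "has_zero_sum_block Q7 (w # xs)"
      using 2 has_zero_sum_block_if_blocks k(2) by blast
    then show ?thesis
      by (rule has_zero_sum_block_mono) simp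
  next
    case False
    show ?thesis
      unfolding k(2)
      by (rule "2.IH"[OF k(1)])
        (use 2 k(1) False ws attained_at_front_extend in auto)
  qed
  then show ?case by (simp add: ws)
qed

text \<open>The innermost 0 is the last term of the sequence and 1 the term before it; 7 of the 9
  terms are left to search.\<close>

lemma blocked_0_1: "all_extensions_blocked 7 (extend_sums 1 (extend_sums 0 []))"
  by code_simp

lemma blocked_0_0_1:
  "all_extensions_blocked 6 (extend_sums 1 (extend_sums 0 (extend_sums 0 [])))"
  by code_simp

text \<open>Three zeros form a zero-sum block, since 1 + 2 + 4 = 0 modulo 7.\<close>

lemma blocks_0_0: "blocks 0 (extend_sums 0 (extend_sums 0 []))"
  by code_simp

section \<open>Normalisation of sequences of length 9\<close>

lemma unit_7: "u \<noteq> 0 \<Longrightarrow> \<exists>v. u * v = (1 :: 7)"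
proof -
  assume "u \<noteq> 0"
  then have "u \<in> {1, 2, 3, 4, 5, 6}"
    using UNIV_I[of u] unfolding UNIV_7 by auto
  moreover have "(1::7) * 1 = 1 \<and> (2::7) * 4 = 1 \<and> (3::7) * 5 = 1 \<and> (4::7) * 2 = 1
      \<and> (5::7) * 3 = 1 \<and> (6::7) * 6 = 1"
    by simp
  ultimately show ?thesis by blast
qed

lemma has_zero_sum_block_9:
  fixes xs :: "7 list"
  assumes "length xs = 9"
  shows "has_zero_sum_block Q7 xs"
proof -
  \<comment> \<open>The map \<open>u * x + c\<close> inverts the normalisation
    \<open>v * (x - c)\<close>, so a block of the normalised list carries back to
    \<open>xs\<close>.\<close>
  have scale: "has_zero_sum_block Q7 xs"
    if "has_zero_sum_block Q7 (map (\<lambda>x. v * (x - c)) xs)" "u * v = 1" for u v c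
  proof -
    have "map (\<lambda>x. u * x + c) (map (\<lambda>x. v * (x - c)) xs) = xs"
      using that(2) by (simp add: mult.assoc[symmetric] o_def)
    then show ?thesis
      using has_zero_sum_block_affine[OF that(1), of u c] by simp
  qed
  obtain c d e ws where rev: "rev xs = c # d # e # ws" and len: "length ws = 6"
  proof -
    have "length (rev xs) = Suc (Suc (Suc 6))"
      using assms by simp
    then show thesis
      using that unfolding length_Suc_conv by blast
  qed
  have xs: "xs = rev ws @ [e, d, c]"
    using rev by (simp add: rev_swap)
  note front_Cons_0 = attained_at_front_extend[of _ _ 0, simplified]
  note front_Cons_1 = attained_at_front_extend[of _ _ 1, simplified]
  note front_0 = front_Cons_0[OF attained_at_front_Nil]
  note front_0_0 = front_Cons_0[OF front_0]
  \<comment> \<open>Subtracting \<open>c\<close> makes the last term 0; the first of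
    \<open>d\<close>, \<open>e\<close> that differs from \<open>c\<close> is then scaled to 1. If
    neither differs, translation alone gives three zeros.\<close>
  consider "d \<noteq> c" | "d = c" "e \<noteq> c" | "d = c" "e = c"
    by blast
  then show ?thesis
  proof cases
    case 1
    then obtain v where v: "(d - c) * v = 1"
      using unit_7[of "d - c"] by auto
    let ?f = "\<lambda>x. v * (x - c)"
    have "has_zero_sum_block Q7 (rev (?f e # map ?f ws) @ [1, 0])"
      by (rule has_zero_sum_block_if_blocked[OF blocked_0_1 front_Cons_1[OF front_0]]) (simp add: len)
    with v show ?thesis
      by (intro scale[of v c, OF _ v]) (simp add: xs rev_map mult.commute)
  next
    case 2
    then obtain v where v: "(e - c) * v = 1"
      using unit_7[of "e - c"] by auto
    let ?f = "\<lambda>x. v * (x - c)"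
    have "has_zero_sum_block Q7 (rev (map ?f ws) @ [1, 0, 0])"
      by (rule has_zero_sum_block_if_blocked[OF blocked_0_0_1 front_Cons_1[OF front_0_0]]) (simp add: len)
    with v 2 show ?thesis
      by (intro scale[of v c, OF _ v]) (simp add: xs rev_map mult.commute)
  next
    case 3
    have "has_zero_sum_block Q7 [0, 0, 0]"
      using has_zero_sum_block_if_blocks[OF front_0_0 blocks_0_0] by simp
    then have "has_zero_sum_block Q7 (rev (map (\<lambda>x. 1 * (x - c)) ws) @ [0, 0, 0])"
      by (rule has_zero_sum_block_mono) simp
    with 3 show ?thesis
      by (intro scale[of 1 c 1]) (simp_all add: xs rev_map)
  qed
qed

theorem theorem3p11: "C_const Q7 = 9"
proof -
  have "C_const Q7 = (LEAST k. k > 0 \<and> (\<forall>xs :: 7 list. length xs = k \<longrightarrow> has_zero_sum_block Q7 xs))"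
    by (simp add: C_const_def has_zero_sum_block_def)
  also have "\<dots> = 9"
  proof (rule Least_equality)
    show "(9::nat) > 0 \<and> (\<forall>xs :: 7 list. length xs = 9 \<longrightarrow> has_zero_sum_block Q7 xs)"
      using has_zero_sum_block_9 by simp
  next
    fix k :: nat
    assume k: "k > 0 \<and> (\<forall>xs :: 7 list. length xs = k \<longrightarrow> has_zero_sum_block Q7 xs)"
    show "9 \<le> k"
    proof (rule ccontr)
      assume "\<not> 9 \<le> k"
      \<comment> \<open>Prefixes of a list without a zero-sum block have none either, so this one
        list of length 8 excludes every smaller \<open>k\<close> as well.\<close>
      define w :: "7 list" where "w = [0, 0, 1, 0, 0, 1, 0, 0]"
      have "length (take k w) = k"
        using \<open>\<not> 9 \<le> k\<close> by (simp add: w_def)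
      then have "has_zero_sum_block Q7 (take k w)"
        using k by blast
      then have "has_zero_sum_block Q7 w"
        by (rule has_zero_sum_block_mono) simp
      then show False
        using no_zero_sum_block_8 by (simp add: w_def)
    qed
  qed
  finally show ?thesis .
qed

end
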